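(* Let $t\ge 2$ and $m\ge 2$ be integers, let $v_1,\ldots,v_t$ be positive integers, and let $h_1,\ldots,h_t$ be integers satisfying (a) $h_1>h_2>\cdots>h_t>0$; (b) $\sum_{k=0}^{h_1-h_2}\binom{h_1}{k}(2^m-1)^k\ \ge\ v_1$; (c) $\sum_{k=1}^{h_i-h_{i+1}}\binom{h_i}{k}(2^m-2)^k\ \ge\ v_i$ for every $i=2,\ldots,t-1$; (d) $(2^m-1)^{h_t}-1\ \ge\ v_t$. Then there exists a $\langle v_1,\ldots,v_t\rangle/(m h_1)$ womcode.
   Context: A write-once memory with $n$ wits has states in $\{0,1\}^n$; it starts in the all-zero state, and each bit can be changed from $0$ to $1$ but never from $1$ to $0$. Write $x\le y$ for the componentwise order on $\{0,1\}^n$. For positive integers $v_1,\ldots,v_t$, a $\langle v_1,\ldots,v_t\rangle/n$ womcode is a code that can write, using $n$ wits, a variable of cardinality $v_1$ the first time, then a variable of cardinality $v_2$ the second time, and so on up to a variable of cardinality $v_t$ the $t$-th time. The decoder sees only the current memory state (not which write produced it, nor when each wit was written). Formally, it consists of encoding maps $E_i:\{0,1\}^n\times\{0,\ldots,v_i-1\}\to\{0,1\}^n$ for $1\le i\le t$ and a single decoding map $D$ on $\{0,1\}^n$ with values in the nonnegative integers, such that for every sequence of messages $a_1,\ldots,a_t$ with $a_i\in\{0,\ldots,v_i-1\}$, the states defined by $x^{(0)}=0$ and $x^{(i)}=E_i(x^{(i-1)},a_i)$ satisfy $x^{(i-1)}\le x^{(i)}$ and $D(x^{(i)})=a_i$ for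 all $i=1,\ldots,t$. *)

theory Defs
  imports Main
begin

(* An element of {0,1}^n is a bool list of length n, with False for 0 and True for 1. *)
definition wit_states :: "nat \<Rightarrow> bool list set" where
  "wit_states n = {x. length x = n}"

definition wit_le :: "bool list \<Rightarrow> bool list \<Rightarrow> bool" where
  "wit_le = list_all2 (\<le>)"

(* Write numbers are 1-based: E i and a i are the encoding map and the message of the
   i-th write; the values E 0 and a 0 are never used. *)
primrec wom_run ::
  "nat \<Rightarrow> (nat \<Rightarrow> bool list \<Rightarrow> nat \<Rightarrow> bool list) \<Rightarrow> (nat \<Rightarrow> nat) \<Rightarrow> nat \<Rightarrow> bool list" where
  "wom_run n E a 0 = replicate n False"
| "wom_run n E a (Suc i) = E (Suc i) (wom_run n E a i) (a (Suc i))"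

definition womcode ::
  "nat \<Rightarrow> (nat \<Rightarrow> nat) \<Rightarrow> nat \<Rightarrow> (nat \<Rightarrow> bool list \<Rightarrow> nat \<Rightarrow> bool list) \<Rightarrow> (bool list \<Rightarrow> nat) \<Rightarrow> bool" where
  "womcode t v n E D \<longleftrightarrow>
     (\<forall>i\<in>{1..t}. \<forall>x\<in>wit_states n. \<forall>b<v i. E i x b \<in> wit_states n) \<and>
     (\<forall>a. (\<forall>i\<in>{1..t}. a i < v i) \<longrightarrow>
        (\<forall>i\<in>{1..t}. wit_le (wom_run n E a (i - 1)) (wom_run n E a i) \<and>
                    D (wom_run n E a i) = a i))"

end

theory Submission
  imports Defs "HOL-Library.FuncSet"
begin

text \<open>
  Split the wits into \<open>h\<^sub>1\<close> blocks of \<open>m\<close> wits. Before the \<open>i\<close>-th write, all wits are set in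
  exactly \<open>h\<^sub>1 - h\<^sub>i\<close> blocks, chosen so as to cover every block touched so far; these blocks are
  dead. The message is then encoded in the \<open>h\<^sub>i\<close> remaining blank blocks by changing at most
  \<open>h\<^sub>i - h\<^sub>i\<^sub>+\<^sub>1\<close> of them (with \<open>h\<^sub>t\<^sub>+\<^sub>1 = 0\<close>), for \<open>i \<ge> 2\<close> at least one, and none of these to all ones.
  The memory state determines \<open>i\<close> and the dead blocks: after the first write at most \<open>h\<^sub>1 - h\<^sub>2\<close>
  blocks are not blank, after later writes more than that; and for \<open>i \<ge> 2\<close> the dead blocks are
  exactly the all-ones blocks, whose number gives \<open>i\<close>.
\<close>

section \<open>Block words and configurations\<close>

definition word :: "nat \<Rightarrow> nat \<Rightarrow> (nat \<Rightarrow> nat set) \<Rightarrow> bool list" where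
  "word m n b = map (\<lambda>p. p mod m \<in> b (p div m)) [0..<m * n]"

definition touched :: "nat \<Rightarrow> bool list \<Rightarrow> nat set" where
  "touched m x = (\<lambda>p. p div m) ` {p. p < length x \<and> x ! p}"

definition fill :: "nat \<Rightarrow> nat set \<Rightarrow> nat set \<times> (nat \<Rightarrow> nat set) \<Rightarrow> nat \<Rightarrow> nat set" where
  "fill m A c = (\<lambda>j. if j \<in> A then {..<m} else if j \<in> fst c then snd c j else {})"

text \<open>A configuration is a set of newly changed blocks with their contents. The extensional
  function space makes each choice of contents a single function, so that cardinalities come out
  right.\<close>

definition configs :: "nat set \<Rightarrow> nat set \<Rightarrow> 'a set \<Rightarrow> (nat set \<times> (nat \<Rightarrow> 'a)) set" where
  "configs B R W = (SIGMA K:{K. K \<subseteq> B \<and> card K \<in> R}. K \<rightarrow>\<^sub>E W)"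

lemma length_word [simp]: "length (word m n b) = m * n"
  by (simp add: word_def)

lemma touched_blank: "touched m (replicate N False) = {}"
  by (auto simp: touched_def)

lemma word_eqD:
  assumes "word m n b = word m n b'" "j < n" "b j \<subseteq> {..<m}" "b' j \<subseteq> {..<m}"
  shows "b j = b' j"
proof -
  have "r \<in> b j \<longleftrightarrow> r \<in> b' j" if "r < m" for r
  proof -
    have "m * j + r < m * Suc j" using that by simp
    also have "\<dots> \<le> m * n" using \<open>j < n\<close> by (intro mult_le_mono2) simp
    finally have "m * j + r < m * n" .
    moreover have "word m n b ! (m * j + r) = word m n b' ! (m * j + r)"
      using assms(1) by simp
    ultimately show ?thesis using that by (simp add: word_def)
  qed
  then show ?thesis using assms(3,4) by blast
qed

lemma touched_subset: "length x = m * n \<Longrightarrow> touched m x \<subseteq> {..<n}"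
  by (auto simp: touched_def less_mult_imp_div_less mult.commute)

lemma touched_fill: "touched m (word m n (fill m A c)) \<subseteq> A \<union> fst c"
  by (auto simp: touched_def word_def fill_def split: if_splits)

text \<open>Every wit set in \<open>x\<close> lies in a block of \<open>A\<close>, and those blocks
  become all ones, so nothing is erased whatever \<open>c\<close> is.\<close>

lemma wit_le_word_fill:
  assumes "m > 0" "length x = m * n" "touched m x \<subseteq> A"
  shows "wit_le x (word m n (fill m A c))"
  using assms unfolding wit_le_def list_all2_conv_all_nth
  by (auto simp: word_def touched_def fill_def image_subset_iff)

text \<open>Choose the \<open>k\<close> blocks to change, then their contents: this gives the shape
  of the sums in the hypotheses.\<close>

lemma card_configs:
  assumes "finite B" "finite R" "finite W"
  shows "card (configs B R W) = (\<Sum>k\<in>R. (card B choose k) * card W ^ k)"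
proof -
  have finK: "finite K" if "K \<subseteq> B" for K
    using assms(1) that by (auto intro: finite_subset)
  have "card (configs B R W) = (\<Sum>K | K \<subseteq> B \<and> card K \<in> R. card W ^ card K)"
    unfolding configs_def using assms(1,3) finK
    by (subst card_SigmaI) (auto intro!: finite_PiE sum.cong simp: card_funcsetE)
  also have "\<dots> = (\<Sum>k\<in>R. \<Sum>K | K \<in> {K. K \<subseteq> B \<and> card K \<in> R} \<and> card K = k. card W ^ card K)"
    using assms(1,2) by (intro sum.group [symmetric]) auto
  also have "\<dots> = (\<Sum>k\<in>R. (card B choose k) * card W ^ k)"
  proof (intro sum.cong refl)
    fix k assume "k \<in> R"
    then have "{K. K \<in> {K. K \<subseteq> B \<and> card K \<in> R} \<and> card K = k} = {K. K \<subseteq> B \<and> card K = k}"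
      by auto
    then show "(\<Sum>K | K \<in> {K. K \<subseteq> B \<and> card K \<in> R} \<and> card K = k. card W ^ card K)
        = (card B choose k) * card W ^ k"
      using assms(1) by (simp add: n_subsets)
  qed
  finally show ?thesis .
qed

lemma finite_configs: "finite B \<Longrightarrow> finite W \<Longrightarrow> finite (configs B R W)"
  unfolding configs_def
  by (intro finite_SigmaI finite_PiE) (auto elim: finite_subset)

lemma nonblank_fill:
  assumes "c \<in> configs ({..<n} - A) R W" "{} \<notin> W" "A \<subseteq> {..<n}" "m > 0"
  shows "{j. j < n \<and> fill m A c j \<noteq> {}} = A \<union> fst c"
proof -
  have "snd c j \<noteq> {} \<and> j < n" if "j \<in> fst c" for j
    using assms(1,2) that PiE_mem[of "snd c" "fst c" "\<lambda>_. W" j] by (auto simp: configs_def)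
  then show ?thesis
    using assms(3,4) by (auto simp: fill_def lessThan_empty_iff)
qed

lemma full_fill:
  assumes "c \<in> configs ({..<n} - A) R W" "{..<m} \<notin> W" "A \<subseteq> {..<n}" "m > 0"
  shows "{j. j < n \<and> fill m A c j = {..<m}} = A"
proof -
  have "snd c j \<noteq> {..<m}" if "j \<in> fst c" for j
    using assms(1,2) that PiE_mem[of "snd c" "fst c" "\<lambda>_. W" j] by (auto simp: configs_def)
  then show ?thesis
    using assms(3,4) by (auto simp: fill_def lessThan_empty_iff split: if_splits)
qed

text \<open>With blank contents excluded, the changed blocks are exactly the nonblank ones outside
  \<open>A\<close>, and their contents can be read off.\<close>

lemma fill_inj:
  assumes c: "c \<in> configs ({..<n} - A) R W" and d: "d \<in> configs ({..<n} - A) R W"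
    and W: "{} \<notin> W" and eq: "\<And>j. j < n \<Longrightarrow> fill m A c j = fill m A d j"
    and "A \<subseteq> {..<n}" "m > 0"
  shows "c = d"
proof -
  have "{j. j < n \<and> fill m A c j \<noteq> {}} = {j. j < n \<and> fill m A d j \<noteq> {}}"
    using eq by auto
  then have "A \<union> fst c = A \<union> fst d"
    by (simp only: nonblank_fill[OF c W assms(5,6)] nonblank_fill[OF d W assms(5,6)])
  moreover have sub: "fst c \<subseteq> {..<n} - A" "fst d \<subseteq> {..<n} - A"
    using c d by (auto simp: configs_def)
  ultimately have K: "fst c = fst d" by blast
  have "snd c = snd d"
  proof (rule PiE_ext)
    show "snd c \<in> fst c \<rightarrow>\<^sub>E W" "snd d \<in> fst c \<rightarrow>\<^sub>E W"
      using c d K by (auto simp: configs_def)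
    fix j assume "j \<in> fst c"
    then show "snd c j = snd d j"
      using eq[of j] sub K by (auto simp: fill_def)
  qed
  with K show ?thesis by (simp add: prod_eq_iff)
qed

section \<open>The code and its parameters\<close>

locale block_code =
  fixes t m :: nat and v h :: "nat \<Rightarrow> nat"
  assumes t: "t \<ge> 2" and m: "m \<ge> 2"
    and h_Suc: "\<And>i. i \<in> {1..<t} \<Longrightarrow> h (i + 1) < h i"
    and v_first: "v 1 \<le> (\<Sum>k = 0..h 1 - h 2. (h 1 choose k) * (2 ^ m - 1) ^ k)"
    and v_middle: "\<And>i. i \<in> {2..t - 1} \<Longrightarrow>
      v i \<le> (\<Sum>k = 1..h i - h (i + 1). (h i choose k) * (2 ^ m - 2) ^ k)"
    and v_last: "v t \<le> (2 ^ m - 1) ^ h t - 1"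
begin

definition n :: nat where "n = h 1"

text \<open>Setting the value after \<open>h t\<close> to 0 lets the last write be treated like the
  middle ones.\<close>

definition next_h :: "nat \<Rightarrow> nat" where
  "next_h i = (if i < t then h (Suc i) else 0)"

text \<open>All ones is reserved as the mark of a dead block, except at the first write, when no
  block is dead.\<close>

definition alphabet :: "nat \<Rightarrow> nat set set" where
  "alphabet i = Pow {..<m} - (if i = 1 then {{}} else {{}, {..<m}})"

text \<open>Later writes must change at least one block; this pushes the number of nonblank blocks
  above \<open>n - h 2\<close>, the maximum after the first write.\<close>

definition sizes :: "nat \<Rightarrow> nat set" where
  "sizes i = {(if i = 1 then 0 else 1)..h i - next_h i}"

definition dead :: "nat \<Rightarrow> nat set set" where
  "dead i = {A. A \<subseteq> {..<n} \<and> card A = n - h i}"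

definition admissible :: "nat \<Rightarrow> nat set \<Rightarrow> (nat set \<times> (nat \<Rightarrow> nat set)) set" where
  "admissible i A = configs ({..<n} - A) (sizes i) (alphabet i)"

text \<open>Any injection serves, since it depends only on \<open>i\<close> and \<open>A\<close>,
  which the memory state reveals.\<close>

definition enc :: "nat \<Rightarrow> nat set \<Rightarrow> nat \<Rightarrow> nat set \<times> (nat \<Rightarrow> nat set)" where
  "enc i A = (SOME f. f ` {..<v i} \<subseteq> admissible i A \<and> inj_on f {..<v i})"

definition code :: "nat \<Rightarrow> nat set \<Rightarrow> nat \<Rightarrow> bool list" where
  "code i A a = word m n (fill m A (enc i A a))"

text \<open>In a state where no suitable \<open>A\<close> exists the choice is unspecified, but the
  result still has the right length.\<close>

definition E :: "nat \<Rightarrow> bool list \<Rightarrow> nat \<Rightarrow> bool list" where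
  "E i x a = code i (SOME A. A \<in> dead i \<and> touched m x \<subseteq> A) a"

definition D :: "bool list \<Rightarrow> nat" where
  "D x = (THE a. \<exists>i A. i \<in> {1..t} \<and> A \<in> dead i \<and> a < v i \<and> x = code i A a)"

lemma h_less: "1 \<le> i \<Longrightarrow> i < j \<Longrightarrow> j \<le> t \<Longrightarrow> h j < h i"
proof (induction j)
  case (Suc j)
  then show ?case using h_Suc[of j] by (cases "i = j") auto
qed simp

lemma h_le: "i \<in> {1..t} \<Longrightarrow> h i \<le> n"
  using h_less[of 1 i] by (cases "i = 1") (auto simp: n_def)

lemma next_le: "i \<in> {1..t} \<Longrightarrow> next_h i \<le> h i"
  using h_less[of i "Suc i"] by (auto simp: next_h_def)

lemma m_pos: "m > 0"
  using m by simp

lemma blank_notin_alphabet: "{} \<notin> alphabet i"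
  by (simp add: alphabet_def)

lemma full_notin_alphabet: "i \<noteq> 1 \<Longrightarrow> {..<m} \<notin> alphabet i"
  by (simp add: alphabet_def)

lemma alphabet_subset: "B \<in> alphabet i \<Longrightarrow> B \<subseteq> {..<m}"
  by (simp add: alphabet_def)

lemma finite_alphabet: "finite (alphabet i)"
  by (simp add: alphabet_def)

lemma card_alphabet: "card (alphabet i) = (if i = 1 then 2 ^ m - 1 else 2 ^ m - 2)"
proof -
  have "{} \<noteq> {..<m}" using m_pos by auto
  then show ?thesis by (simp add: alphabet_def card_Diff_subset card_Pow numeral_2_eq_2)
qed

lemma dead_subset: "A \<in> dead i \<Longrightarrow> A \<subseteq> {..<n}"
  by (simp add: dead_def)

lemma card_dead: "A \<in> dead i \<Longrightarrow> card A = n - h i"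
  by (simp add: dead_def)

lemma finite_dead: "A \<in> dead i \<Longrightarrow> finite A"
  using dead_subset finite_subset by (metis finite_lessThan)

text \<open>Binomial expansion of \<open>((2 ^ m - 2) + 1) ^ p\<close> without its term for
  \<open>k = 0\<close>. It brings the bound on \<open>v t\<close> into the form of the middle
  bounds, with \<open>next_h t = 0\<close>.\<close>

lemma power_eq_sum: "((2::nat) ^ m - 1) ^ p - 1 = (\<Sum>k = 1..p. (p choose k) * (2 ^ m - 2) ^ k)"
proof -
  \<comment> \<open>This bound keeps the truncated subtractions exact.\<close>
  have "(2::nat) ^ 2 \<le> 2 ^ m" using m by (intro power_increasing) auto
  then have "(2::nat) ^ m - 1 = (2 ^ m - 2) + 1" by simp
  then have "((2::nat) ^ m - 1) ^ p = ((2 ^ m - 2) + 1) ^ p" by (simp only:)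
  also have "\<dots> = (\<Sum>k\<le>p. (p choose k) * (2 ^ m - 2) ^ k)"
    by (subst binomial) simp
  also have "\<dots> = 1 + (\<Sum>k = 1..p. (p choose k) * (2 ^ m - 2) ^ k)"
    by (simp add: atMost_atLeast0 sum.atLeast_Suc_atMost)
  finally show ?thesis by simp
qed

lemma v_le: "i \<in> {1..t} \<Longrightarrow> v i \<le> (\<Sum>k\<in>sizes i. (h i choose k) * card (alphabet i) ^ k)"
proof -
  assume "i \<in> {1..t}"
  then consider "i = 1" | "i \<in> {2..t - 1}" "i \<noteq> 1" "i < t" | "i = t" "i \<noteq> 1" by force
  then show ?thesis
  proof cases
    case 1
    then show ?thesis using t v_first by (simp add: card_alphabet sizes_def next_h_def numeral_2_eq_2)
  next
    case 2
    then show ?thesis using v_middle[of i] by (simp add: card_alphabet sizes_def next_h_def)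
  next
    case 3
    then show ?thesis using v_last[unfolded power_eq_sum] by (simp add: card_alphabet sizes_def next_h_def)
  qed
qed

text \<open>Since \<open>h i \<le> n\<close>, exactly \<open>h i\<close> blocks lie outside a dead
  set of size \<open>n - h i\<close>.\<close>

lemma card_admissible:
  assumes "i \<in> {1..t}" "A \<in> dead i"
  shows "v i \<le> card (admissible i A)"
proof -
  have "card ({..<n} - A) = h i"
    using assms h_le finite_dead card_dead dead_subset by (simp add: card_Diff_subset)
  then have "card (admissible i A) = (\<Sum>k\<in>sizes i. (h i choose k) * card (alphabet i) ^ k)"
    by (simp add: admissible_def card_configs sizes_def finite_alphabet)
  with v_le[OF assms(1)] show ?thesis by simp
qed

lemma enc:
  assumes "i \<in> {1..t}" "A \<in> dead i"
  shows "enc i A ` {..<v i} \<subseteq> admissible i A" "inj_on (enc i A) {..<v i}"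
proof -
  have "finite (admissible i A)"
    unfolding admissible_def by (intro finite_configs finite_alphabet) auto
  then have "\<exists>f. f ` {..<v i} \<subseteq> admissible i A \<and> inj_on f {..<v i}"
    using card_admissible[OF assms] by (intro card_le_inj) auto
  then have "enc i A ` {..<v i} \<subseteq> admissible i A \<and> inj_on (enc i A) {..<v i}"
    unfolding enc_def by (rule someI_ex)
  then show "enc i A ` {..<v i} \<subseteq> admissible i A" "inj_on (enc i A) {..<v i}" by simp_all
qed

lemma enc_in_admissible: "i \<in> {1..t} \<Longrightarrow> A \<in> dead i \<Longrightarrow> a < v i \<Longrightarrow> enc i A a \<in> admissible i A"
  using enc(1) by blast

section \<open>Unique decodability\<close>

lemma admissibleD:
  assumes "c \<in> admissible i A"
  shows "fst c \<subseteq> {..<n} - A" "card (fst c) \<in> sizes i"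
  using assms by (auto simp: admissible_def configs_def)

lemma fill_subset:
  assumes "c \<in> admissible i A"
  shows "fill m A c k \<subseteq> {..<m}"
  using assms alphabet_subset[of "snd c k" i] PiE_mem[of "snd c" "fst c" "\<lambda>_. alphabet i" k]
  by (auto simp: fill_def admissible_def configs_def split: if_splits)

lemma nonblank_blocks:
  assumes "A \<in> dead i" "c \<in> admissible i A"
  shows "{k. k < n \<and> fill m A c k \<noteq> {}} = A \<union> fst c"
  using nonblank_fill[OF assms(2)[unfolded admissible_def] blank_notin_alphabet dead_subset[OF assms(1)] m_pos] .

lemma full_blocks:
  assumes "A \<in> dead i" "c \<in> admissible i A" "i \<noteq> 1"
  shows "{k. k < n \<and> fill m A c k = {..<m}} = A"
  using full_fill[OF assms(2)[unfolded admissible_def] full_notin_alphabet[OF assms(3)] dead_subset[OF assms(1)] m_pos] .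

lemma card_nonblank:
  assumes "A \<in> dead i" "c \<in> admissible i A"
  shows "card (A \<union> fst c) = (n - h i) + card (fst c)"
proof -
  have "finite (fst c)" using admissibleD(1)[OF assms(2)] by (auto elim: finite_subset)
  then show ?thesis
    using admissibleD(1)[OF assms(2)] finite_dead[OF assms(1)] card_dead[OF assms(1)]
    by (subst card_Un_disjoint) auto
qed

text \<open>The first write leaves at most \<open>h 1 - h 2\<close> nonblank blocks. For
  \<open>i \<ge> 2\<close> there are already \<open>n - h i \<ge> n - h 2\<close> dead ones, and at
  least one more is changed.\<close>

lemma nonblank_first_iff:
  assumes "i \<in> {1..t}" "A \<in> dead i" "c \<in> admissible i A"
  shows "card (A \<union> fst c) \<le> n - h 2 \<longleftrightarrow> i = 1"
proof (cases "i = 1")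
  case True
  then show ?thesis
    using card_nonblank[OF assms(2,3)] admissibleD(2)[OF assms(3)] t
    by (simp add: sizes_def next_h_def n_def numeral_2_eq_2)
next
  case False
  have "h i \<le> h 2"
    using h_less[of 2 i] assms(1) False by (cases "i = 2") auto
  moreover have "h 2 \<le> n" using h_le[of 2] t by simp
  moreover have "card (fst c) \<ge> 1" using admissibleD(2)[OF assms(3)] False by (simp add: sizes_def)
  ultimately show ?thesis
    using card_nonblank[OF assms(2,3)] False by simp
qed

lemma dead_first: "A \<in> dead 1 \<Longrightarrow> A = {}"
  using finite_dead[of A 1] card_dead[of A 1] by (simp add: n_def)

text \<open>The number of nonblank blocks separates the first write from the others. For later
  writes the all-ones blocks give the dead set, whose size gives \<open>i\<close> because
  \<open>h\<close> is strictly decreasing. The configuration then follows from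
  \<open>fill_inj\<close>.\<close>

lemma word_fill_eqD:
  assumes i: "i \<in> {1..t}" "A \<in> dead i" "c \<in> admissible i A"
    and j: "j \<in> {1..t}" "B \<in> dead j" "d \<in> admissible j B"
    and eq: "word m n (fill m A c) = word m n (fill m B d)"
  shows "i = j \<and> A = B \<and> c = d"
proof -
  have same: "fill m A c k = fill m B d k" if "k < n" for k
    by (rule word_eqD[OF eq that fill_subset[OF i(3)] fill_subset[OF j(3)]])
  then have "{k. k < n \<and> fill m A c k \<noteq> {}} = {k. k < n \<and> fill m B d k \<noteq> {}}"
    by auto
  then have "A \<union> fst c = B \<union> fst d"
    by (simp only: nonblank_blocks[OF i(2,3)] nonblank_blocks[OF j(2,3)])
  then have first: "i = 1 \<longleftrightarrow> j = 1"
    using nonblank_first_iff[OF i] nonblank_first_iff[OF j] by simp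
  have "i = j \<and> A = B"
  proof (cases "i = 1")
    \<comment> \<open>Here \<open>n = h 1\<close>, so both dead sets are empty.\<close>
    case True
    then show ?thesis using first dead_first i(2) j(2) by metis
  next
    case False
    then have "j \<noteq> 1" using first by simp
    have "{k. k < n \<and> fill m A c k = {..<m}} = {k. k < n \<and> fill m B d k = {..<m}}"
      using same by auto
    then have AB: "A = B"
      by (simp only: full_blocks[OF i(2,3) False] full_blocks[OF j(2,3) \<open>j \<noteq> 1\<close>])
    then have "h i = h j"
      using card_dead[OF i(2)] card_dead[OF j(2)] h_le[OF i(1)] h_le[OF j(1)] by simp
    then have "i = j"
      using h_less[of i j] h_less[of j i] i(1) j(1) by (cases i j rule: linorder_cases) auto
    with AB show ?thesis by simp
  qed
  then have [simp]: "j = i" "B = A" by simp_all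
  have "c = d"
    by (rule fill_inj[of c n A "sizes i" "alphabet i" d m])
      (use i j same dead_subset blank_notin_alphabet m_pos in \<open>auto simp: admissible_def\<close>)
  then show ?thesis by simp
qed

lemma code_eqD:
  assumes "i \<in> {1..t}" "A \<in> dead i" "a < v i" "j \<in> {1..t}" "B \<in> dead j" "b < v j"
    and "code i A a = code j B b"
  shows "a = b"
proof -
  have "i = j \<and> A = B \<and> enc i A a = enc j B b"
    using assms by (intro word_fill_eqD enc_in_admissible) (simp_all add: code_def)
  then show ?thesis using enc(2)[OF assms(1,2)] assms(3,6) by (auto dest: inj_onD)
qed

lemma D_code:
  assumes "i \<in> {1..t}" "A \<in> dead i" "a < v i"
  shows "D (code i A a) = a"
  unfolding D_def using assms by (intro the_equality) (blast dest: code_eqD)+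

section \<open>Correctness of successive writes\<close>

lemma length_E: "length (E i x a) = m * n"
  by (simp add: E_def code_def)

text \<open>The bound on touched blocks is the invariant: for \<open>i < t\<close> the bound
  obtained after write \<open>i\<close> is the one required before the next write.\<close>

lemma write_step:
  assumes i: "i \<in> {1..t}" and x: "length x = m * n" "card (touched m x) \<le> n - h i"
    and a: "a < v i"
  shows "wit_le x (E i x a)" "D (E i x a) = a" "card (touched m (E i x a)) \<le> n - next_h i"
proof -
  define A where "A = (SOME A. A \<in> dead i \<and> touched m x \<subseteq> A)"
  \<comment> \<open>The touched blocks are padded with arbitrary further blocks to reach exactly
    \<open>n - h i\<close>, the size the decoder relies on.\<close>
  have "\<exists>A. touched m x \<subseteq> A \<and> A \<subseteq> {..<n} \<and> card A = n - h i"
    using x by (intro exists_subset_between touched_subset) auto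
  then have A: "A \<in> dead i" "touched m x \<subseteq> A"
    using someI_ex[of "\<lambda>A. A \<in> dead i \<and> touched m x \<subseteq> A"] by (auto simp: A_def dead_def)
  have E: "E i x a = code i A a" by (simp add: E_def A_def)
  have c: "enc i A a \<in> admissible i A" using enc_in_admissible[OF i A(1) a] .
  have "finite (A \<union> fst (enc i A a))"
    using admissibleD(1)[OF c] finite_dead[OF A(1)] by (auto elim: finite_subset)
  then have "card (touched m (E i x a)) \<le> card (A \<union> fst (enc i A a))"
    unfolding E code_def using touched_fill by (rule card_mono)
  also have "\<dots> \<le> (n - h i) + (h i - next_h i)"
    using card_nonblank[OF A(1) c] admissibleD(2)[OF c] by (simp add: sizes_def)
  also have "\<dots> = n - next_h i" using h_le[OF i] next_le[OF i] by simp
  finally show "card (touched m (E i x a)) \<le> n - next_h i" .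
  show "wit_le x (E i x a)"
    using wit_le_word_fill[OF m_pos x(1) A(2)] by (simp add: E code_def)
  show "D (E i x a) = a"
    using D_code[OF i A(1) a] by (simp add: E)
qed

lemma length_run: "length (wom_run (m * n) E a i) = m * n"
  by (cases i) (simp_all add: length_E)

lemma card_touched_run:
  assumes "\<forall>i\<in>{1..t}. a i < v i" "i < t"
  shows "card (touched m (wom_run (m * n) E a i)) \<le> n - h (Suc i)"
  using assms(2)
proof (induction i)
  case 0
  then show ?case by (simp add: touched_blank)
next
  case (Suc i)
  then show ?case
    using write_step(3)[of "Suc i" "wom_run (m * n) E a i" "a (Suc i)"] assms(1) length_run
    by (simp add: next_h_def)
qed

lemma womcode: "womcode t v (m * n) E D"
  unfolding womcode_def
proof (intro conjI allI impI ballI)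
  show "E i x b \<in> wit_states (m * n)" for i x b
    by (simp add: length_E wit_states_def)
next
  fix a i assume a: "\<forall>i\<in>{1..t}. a i < v i" and i: "i \<in> {1..t}"
  \<comment> \<open>The invariant concerns the state before write \<open>i\<close>, hence the run of
    length \<open>k = i - 1\<close>.\<close>
  then obtain k where k: "i = Suc k" by (cases i) auto
  note step = write_step[OF i length_run, of a k "a i"]
  have "card (touched m (wom_run (m * n) E a k)) \<le> n - h i" "a i < v i"
    using card_touched_run[OF a, of k] a i k by auto
  from step[OF this]
  show "wit_le (wom_run (m * n) E a (i - 1)) (wom_run (m * n) E a i)"
    and "D (wom_run (m * n) E a i) = a i"
    by (simp_all add: k)
qed

end

theorem theorem1:
  fixes t m :: nat and v h :: "nat \<Rightarrow> nat"
  assumes "t \<ge> 2" and "m \<ge> 2"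
    and "\<And>i. i \<in> {1..t} \<Longrightarrow> v i > 0"
    and "\<And>i. i \<in> {1..<t} \<Longrightarrow> h i > h (i + 1)" and "h t > 0"
    and "(\<Sum>k = 0..h 1 - h 2. (h 1 choose k) * (2 ^ m - 1) ^ k) \<ge> v 1"
    and "\<And>i. i \<in> {2..t - 1} \<Longrightarrow>
           (\<Sum>k = 1..h i - h (i + 1). (h i choose k) * (2 ^ m - 2) ^ k) \<ge> v i"
    and "(2 ^ m - 1) ^ h t - 1 \<ge> v t"
  shows "\<exists>E D. womcode t v (m * h 1) E D"
proof -
  interpret block_code t m v h
    using assms by unfold_locales auto
  show ?thesis using womcode by (auto simp: n_def)
qed

end
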